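(* Let $D=(d_{ij})\in\mathbb{R}^{m\times m}$ be a dissimilarity matrix, let $D_{sq}=(d_{ij}^2)$ be the matrix of squared entries of $D$, and let $\lambda_m$ be the smallest eigenvalue of $$\left(\mathbf{I}-\tfrac{1}{m}\mathbf{1}\mathbf{1}^T\right)\left(-\tfrac12 D_{sq}\right)\left(\mathbf{I}-\tfrac{1}{m}\mathbf{1}\mathbf{1}^T\right).$$ Let $\sigma$ be any real constant with $\sigma\ge-\lambda_m$. Define $D'=(d'_{ij})$ by $d'_{ii}=0$ and $d'_{ij}=\sqrt{d_{ij}^2+2\sigma}$ for $i\ne j$. Then $D'$ is a Euclidean distance matrix.
   Context: A dissimilarity matrix is a real symmetric matrix with non-negative entries and zero diagonal (no triangle inequality is required). $\mathbf{I}$ is the $m\times m$ identity matrix and $\mathbf{1}\in\mathbb{R}^m$ is the all-ones vector. A matrix $D'=(d'_{ij})\in\mathbb{R}^{m\times m}$ is called a Euclidean distance matrix if there exist some $n$ and points $\mathbf{x}_1,\dots,\mathbf{x}_m\in\mathbb{R}^n$ with $d'_{ij}=\|\mathbf{x}_i-\mathbf{x}_j\|$ (Euclidean norm) for all $i,j$. *)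

theory Defs
  imports "HOL-Analysis.Analysis"
begin

definition dissimilarity_matrix :: "real ^ 'm ^ 'm \<Rightarrow> bool" where
  "dissimilarity_matrix D \<longleftrightarrow>
     transpose D = D \<and> (\<forall>i j. 0 \<le> D $ i $ j) \<and> (\<forall>i. D $ i $ i = 0)"

(* The dimension n is existentially quantified, so a point of R^n is a function
   nat => real of which only the coordinates k < n are used; L2_set over {..<n}
   is the Euclidean norm. *)
definition euclidean_distance_matrix :: "real ^ 'm ^ 'm \<Rightarrow> bool" where
  "euclidean_distance_matrix D \<longleftrightarrow>
     (\<exists>(n::nat) (x :: 'm \<Rightarrow> nat \<Rightarrow> real).
        \<forall>i j. D $ i $ j = L2_set (\<lambda>k. x i k - x j k) {..<n})"

definition squared_entries :: "real ^ 'm ^ 'm \<Rightarrow> real ^ 'm ^ 'm" where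
  "squared_entries D = (\<chi> i j. (D $ i $ j)\<^sup>2)"

(* The vector 1 is the constant-one vector, whereas the matrix mat 1 is the identity. *)
definition centering_matrix :: "real ^ 'm ^ 'm" where
  "centering_matrix =
     mat 1 - (1 / real CARD('m)) *\<^sub>R
       ((columnvector (1 :: real ^ 'm) :: real ^ 1 ^ 'm) **
        transpose (columnvector (1 :: real ^ 'm) :: real ^ 1 ^ 'm))"

definition eigenvalue :: "real ^ 'm ^ 'm \<Rightarrow> real \<Rightarrow> bool" where
  "eigenvalue A k \<longleftrightarrow> (\<exists>v. v \<noteq> 0 \<and> A *v v = k *\<^sub>R v)"

(* Meaningful when A has a real eigenvalue, in particular for symmetric A;
   Min of the empty set is unspecified. *)
definition smallest_eigenvalue :: "real ^ 'm ^ 'm \<Rightarrow> real" where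
  "smallest_eigenvalue A = Min {k. eigenvalue A k}"

end

(* Write P for the centering matrix, M for -1/2 times the matrix of squared
   dissimilarities, and A = P M P. The quadratic form of A is at least its smallest
   eigenvalue times the squared norm, so G = A + sigma P satisfies
   x . G x = Px . A Px + sigma |Px|^2 >= 0 and is the Gram matrix of points y_i.
   The vector u = e_i - e_j is fixed by P, hence
   |y_i - y_j|^2 = u . G u = u . M u + sigma |u|^2 = d_ij^2 + 2 sigma. *)
theory Submission
  imports Defs
begin

section \<open>Spectral theorem for self-adjoint maps and symmetric matrices\<close>

lemma quadratic_nonneg_imp_linear_coeff_0:
  fixes a c :: real
  assumes "\<And>t. 0 \<le> 2 * t * a + t\<^sup>2 * c"
  shows "a = 0"
proof (rule ccontr)
  assume "a \<noteq> 0"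
  \<comment> \<open>With \<open>C\<close> above both \<open>0\<close> and \<open>c\<close>, the
    choice \<open>t = - (a / C)\<close> makes the quadratic negative unless
    \<open>a = 0\<close>.\<close>
  define C where "C = \<bar>c\<bar> + 1"
  have C: "C > 0" "c < C" by (auto simp: C_def)
  have "2 * (- (a / C)) * a + (- (a / C))\<^sup>2 * c = (a / C)\<^sup>2 * (c - 2 * C)"
    using C by (simp add: field_simps power2_eq_square)
  also have "\<dots> < 0"
    using C \<open>a \<noteq> 0\<close> by (intro mult_pos_neg) auto
  finally show False
    using assms[of "- (a / C)"] by linarith
qed

text \<open>Compactness gives a minimiser \<open>e\<close> of the quadratic form on the unit sphere
  of \<open>S\<close>. With \<open>k\<close> the minimum, the form of \<open>f - k\<close> is
  nonnegative on \<open>S\<close> and zero at \<open>e\<close>, so its first variation at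
  \<open>e\<close> vanishes; this forces \<open>f e = k *\<^sub>R e\<close>.\<close>

lemma selfadjoint_eigenvector_exists:
  fixes f :: "'a::euclidean_space \<Rightarrow> 'a"
  assumes lin: "linear f" and sa: "\<And>x y. f x \<bullet> y = x \<bullet> f y"
    and S: "subspace S" "f ` S \<subseteq> S" "S \<noteq> {0}"
  obtains e k where "e \<in> S" "norm e = 1" "f e = k *\<^sub>R e"
proof -
  interpret f: linear f by fact
  have "compact (sphere 0 1 \<inter> S)"
    using S(1) by (intro compact_Int_closed closed_subspace) auto
  moreover obtain x where x: "x \<in> S" "x \<noteq> 0"
    using S(1,3) subspace_0 by blast
  then have "x /\<^sub>R norm x \<in> sphere 0 1 \<inter> S"
    using S(1) by (auto simp: subspace_scale)
  moreover have "continuous_on (sphere 0 1 \<inter> S) (\<lambda>x. x \<bullet> f x)"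
    using lin by (intro continuous_intros linear_continuous_on) (simp add: linear_linear)
  ultimately obtain e where e: "e \<in> S" "norm e = 1"
      and emin: "\<And>y. y \<in> S \<Longrightarrow> norm y = 1 \<Longrightarrow> e \<bullet> f e \<le> y \<bullet> f y"
    using continuous_attains_inf[of "sphere 0 1 \<inter> S" "\<lambda>x. x \<bullet> f x"] by fastforce
  define k where "k = e \<bullet> f e"
  have nonneg: "0 \<le> v \<bullet> f v - k * (v \<bullet> v)" if "v \<in> S" for v
  proof (cases "v = 0")
    case False
    define u where "u = v /\<^sub>R norm v"
    have "u \<in> S" "norm u = 1" and v: "v = norm v *\<^sub>R u"
      using False that S(1) by (auto simp: u_def subspace_scale)
    then have "k \<le> u \<bullet> f u" and uu: "u \<bullet> u = 1"
      using emin by (auto simp: k_def norm_eq_1)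
    then have "0 \<le> (norm v)\<^sup>2 * (u \<bullet> f u - k)" by simp
    also have "\<dots> = (norm v *\<^sub>R u) \<bullet> f (norm v *\<^sub>R u) - k * ((norm v *\<^sub>R u) \<bullet> (norm v *\<^sub>R u))"
      using uu by (simp add: f.scale power2_eq_square algebra_simps)
    finally show ?thesis using v by simp
  qed simp
  \<comment> \<open>The residual lies in \<open>S\<close> by invariance, so it is an admissible
    direction of variation. By self-adjointness the linear coefficient in \<open>t\<close> is then
    \<open>2 * (w \<bullet> w)\<close>.\<close>
  define w where "w = f e - k *\<^sub>R e"
  have w: "w \<in> S"
    unfolding w_def using S e by (intro subspace_diff subspace_scale) auto
  have "w \<bullet> w = 0"
  proof (rule quadratic_nonneg_imp_linear_coeff_0)
    fix t :: real
    have "e + t *\<^sub>R w \<in> S"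
      using S e w by (intro subspace_add subspace_scale) auto
    note nonneg[OF this]
    also have "(e + t *\<^sub>R w) \<bullet> f (e + t *\<^sub>R w) - k * ((e + t *\<^sub>R w) \<bullet> (e + t *\<^sub>R w))
        = (e \<bullet> f e - k * (e \<bullet> e)) + t * (w \<bullet> f e + e \<bullet> f w - 2 * k * (w \<bullet> e))
          + t\<^sup>2 * (w \<bullet> f w - k * (w \<bullet> w))"
      by (simp add: f.add f.scale inner_add_left inner_add_right algebra_simps
          power2_eq_square inner_commute)
    also have "e \<bullet> f e - k * (e \<bullet> e) = 0"
      using e by (simp add: k_def norm_eq_1)
    also have "w \<bullet> f e + e \<bullet> f w - 2 * k * (w \<bullet> e) = 2 * (w \<bullet> w)"
    proof -
      have "e \<bullet> f w = w \<bullet> f e" using sa[of e w] by (simp add: inner_commute)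
      moreover have "w \<bullet> w = w \<bullet> f e - k * (w \<bullet> e)"
        by (subst (2) w_def) (simp add: inner_diff_right)
      ultimately show ?thesis by simp
    qed
    finally show "0 \<le> 2 * t * (w \<bullet> w) + t\<^sup>2 * (w \<bullet> f w - k * (w \<bullet> w))"
      by (simp add: algebra_simps)
  qed
  then have "f e = k *\<^sub>R e" by (simp add: w_def)
  with e that show thesis by blast
qed

text \<open>Induction on the dimension: split off a unit eigenvector \<open>e\<close>. Its
  orthogonal complement in \<open>S\<close> is again invariant, since
  \<open>e \<bullet> f x = f e \<bullet> x = k * (e \<bullet> x)\<close>, and has smaller
  dimension.\<close>

lemma selfadjoint_eigenbasis_subspace:
  fixes f :: "'a::euclidean_space \<Rightarrow> 'a"
  assumes lin: "linear f" and sa: "\<And>x y. f x \<bullet> y = x \<bullet> f y"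
    and "subspace S" "f ` S \<subseteq> S"
  shows "\<exists>B. finite B \<and> B \<subseteq> S \<and> pairwise orthogonal B \<and> span B = S \<and>
           (\<forall>b\<in>B. norm b = 1 \<and> (\<exists>k. f b = k *\<^sub>R b))"
  using assms(3,4)
proof (induction "dim S" arbitrary: S rule: less_induct)
  case less
  show ?case
  proof (cases "S = {0}")
    case True
    then show ?thesis by (intro exI[of _ "{}"]) auto
  next
    case False
    obtain e k where e: "e \<in> S" "norm e = 1" "f e = k *\<^sub>R e"
      using selfadjoint_eigenvector_exists[OF lin sa less.prems False] by blast
    define T where "T = {x \<in> S. e \<bullet> x = 0}"
    have T: "subspace T"
      using less.prems(1) unfolding T_def subspace_def by (auto simp: inner_add_right)
    have "f ` T \<subseteq> T"
      using less.prems(2) e by (auto simp: T_def simp flip: sa)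
    moreover have "dim T < dim S"
    proof -
      have "e \<notin> T" using e by (auto simp: T_def)
      then have "T \<subset> S" using e(1) unfolding T_def by blast
      then show ?thesis
        using T less.prems(1) by (intro dim_psubset) (metis span_eq_iff)
    qed
    ultimately obtain B where B: "finite B" "B \<subseteq> T" "pairwise orthogonal B" "span B = T"
        and eig: "\<And>b. b \<in> B \<Longrightarrow> norm b = 1 \<and> (\<exists>k. f b = k *\<^sub>R b)"
      using less.hyps[OF _ T] by blast
    have "pairwise orthogonal (insert e B)"
      using B by (auto simp: pairwise_insert orthogonal_def T_def inner_commute)
    moreover have "span (insert e B) = S"
    proof
      show "span (insert e B) \<subseteq> S"
        using B e less.prems(1) by (intro span_minimal) (auto simp: T_def)
      show "S \<subseteq> span (insert e B)"
      proof
        fix x assume "x \<in> S"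
        have "x - (e \<bullet> x) *\<^sub>R e \<in> T"
          using \<open>x \<in> S\<close> e less.prems(1)
          by (auto simp: T_def inner_diff_right norm_eq_1 intro!: subspace_diff subspace_scale)
        then show "x \<in> span (insert e B)"
          using B(4) by (auto simp: span_insert)
      qed
    qed
    ultimately show ?thesis
      using B e eig by (intro exI[of _ "insert e B"]) (auto simp: T_def)
  qed
qed

lemma inner_symmetric_matrix:
  fixes A :: "real ^ 'n ^ 'n"
  assumes "transpose A = A"
  shows "(A *v x) \<bullet> y = x \<bullet> (A *v y)"
  by (metis assms dot_lmul_matrix vector_transpose_matrix)

text \<open>The expansion identity encodes spanning and orthogonality at once: for \<open>c\<close>
  in \<open>B\<close>, pairing the expansion of \<open>c\<close> with the unit vector
  \<open>c\<close> leaves zero for the sum of squares of \<open>b \<bullet> c\<close> over the other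
  \<open>b\<close>. Indexing eigenvalues by basis vectors allows multiplicities.\<close>

definition orthonormal_eigenbasis ::
    "real ^ 'n ^ 'n \<Rightarrow> (real ^ 'n) set \<Rightarrow> (real ^ 'n \<Rightarrow> real) \<Rightarrow> bool" where
  "orthonormal_eigenbasis A B l \<longleftrightarrow>
     finite B \<and> (\<forall>b\<in>B. norm b = 1 \<and> A *v b = l b *\<^sub>R b) \<and>
     (\<forall>x. (\<Sum>b\<in>B. (b \<bullet> x) *\<^sub>R b) = x)"

lemma orthonormal_eigenbasisD:
  assumes "orthonormal_eigenbasis A B l"
  shows "finite B" "b \<in> B \<Longrightarrow> norm b = 1" "b \<in> B \<Longrightarrow> A *v b = l b *\<^sub>R b"
    "(\<Sum>b\<in>B. (b \<bullet> x) *\<^sub>R b) = x"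
  using assms by (auto simp: orthonormal_eigenbasis_def)

lemma symmetric_matrix_spectral:
  fixes A :: "real ^ 'n ^ 'n"
  assumes "transpose A = A"
  obtains B l where "orthonormal_eigenbasis A B l"
proof -
  have sa: "(A *v x) \<bullet> y = x \<bullet> (A *v y)" for x y
    by (rule inner_symmetric_matrix[OF assms])
  obtain B where B: "finite B" "pairwise orthogonal B" "span B = UNIV"
     "\<forall>b\<in>B. norm b = 1 \<and> (\<exists>k. A *v b = k *\<^sub>R b)"
    using selfadjoint_eigenbasis_subspace[OF _ sa, of UNIV] by auto
  then obtain l where l: "\<forall>b\<in>B. A *v b = l b *\<^sub>R b" by (metis (no_types))
  have "(\<Sum>b\<in>B. (b \<bullet> x) *\<^sub>R b) = x" for x
  proof -
    \<comment> \<open>Unit norms turn the sum into the Gram-Schmidt projection. The residual is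
      orthogonal to \<open>span B = UNIV\<close>, hence to itself.\<close>
    have "x - (\<Sum>b\<in>B. (b \<bullet> x) *\<^sub>R b) = x - (\<Sum>b\<in>B. (b \<bullet> x / (b \<bullet> b)) *\<^sub>R b)"
      using B(4) by (intro arg_cong[of _ _ "(-) x"] sum.cong) (auto simp: norm_eq_1)
    also have "\<dots> = 0"
      using Gram_Schmidt_step[OF B(2), of _ x] B(3) unfolding orthogonal_self[symmetric] by simp
    finally show ?thesis by simp
  qed
  with that[of B l] B l show thesis by (simp add: orthonormal_eigenbasis_def)
qed

section \<open>Eigenvalue bounds for quadratic forms, and Gram factorisation\<close>

lemma finite_eigenvalues:
  fixes A :: "real ^ 'n ^ 'n"
  assumes sym: "transpose A = A"
  shows "finite {k. eigenvalue A k}"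
proof -
  obtain B l where basis: "orthonormal_eigenbasis A B l"
    using symmetric_matrix_spectral[OF sym] .
  note B = orthonormal_eigenbasisD[OF basis]
  \<comment> \<open>A nonzero \<open>v\<close> has a nonzero coefficient along some
    \<open>b\<close>; moving \<open>A\<close> across the inner product
    \<open>b \<bullet> (A *v v)\<close> gives \<open>k = l b\<close>. Finiteness is what makes
    \<open>Min\<close> a lower bound of the spectrum.\<close>
  have "k \<in> l ` B" if "v \<noteq> 0" "A *v v = k *\<^sub>R v" for k v
  proof -
    have "\<exists>b\<in>B. b \<bullet> v \<noteq> 0"
    proof (rule ccontr)
      assume "\<not> ?thesis"
      then have "(\<Sum>b\<in>B. (b \<bullet> v) *\<^sub>R b) = 0" by (intro sum.neutral) auto
      with B(4) that(1) show False by simp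
    qed
    then obtain b where b: "b \<in> B" "b \<bullet> v \<noteq> 0" ..
    have "k * (b \<bullet> v) = (A *v b) \<bullet> v"
      using that(2) by (simp add: inner_symmetric_matrix[OF sym])
    also have "\<dots> = l b * (b \<bullet> v)" using B(3) b by simp
    finally show ?thesis using b by auto
  qed
  then have "{k. eigenvalue A k} \<subseteq> l ` B" unfolding eigenvalue_def by blast
  then show ?thesis using B(1) finite_subset by blast
qed

lemma quadratic_form_eigenbasis:
  fixes A :: "real ^ 'n ^ 'n"
  assumes "orthonormal_eigenbasis A B l"
  shows "x \<bullet> (A *v y) = (\<Sum>b\<in>B. l b * (b \<bullet> x) * (b \<bullet> y))"
proof -
  have "x \<bullet> (A *v y) = x \<bullet> (A *v (\<Sum>b\<in>B. (b \<bullet> y) *\<^sub>R b))"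
    using orthonormal_eigenbasisD(4)[OF assms, of y] by simp
  also have "A *v (\<Sum>b\<in>B. (b \<bullet> y) *\<^sub>R b) = (\<Sum>b\<in>B. (b \<bullet> y) *\<^sub>R (A *v b))"
    by (simp add: linear_sum linear_scale)
  also have "\<dots> = (\<Sum>b\<in>B. (b \<bullet> y) *\<^sub>R (l b *\<^sub>R b))"
    using orthonormal_eigenbasisD(3)[OF assms] by (intro sum.cong) auto
  finally show ?thesis
    by (simp add: inner_sum_right inner_commute mult_ac)
qed

text \<open>In an eigenbasis both sides are weighted sums of the same squares of
  \<open>b \<bullet> x\<close>, and each weight \<open>l b\<close> is an eigenvalue.\<close>

lemma smallest_eigenvalue_le_quadratic_form:
  fixes A :: "real ^ 'n ^ 'n"
  assumes sym: "transpose A = A"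
  shows "smallest_eigenvalue A * (x \<bullet> x) \<le> x \<bullet> (A *v x)"
proof -
  obtain B l where basis: "orthonormal_eigenbasis A B l"
    using symmetric_matrix_spectral[OF sym] .
  note B = orthonormal_eigenbasisD[OF basis]
  have l: "smallest_eigenvalue A \<le> l b" if "b \<in> B" for b
  proof -
    have "eigenvalue A (l b)"
      unfolding eigenvalue_def using B(2,3)[OF that] by (intro exI[of _ b]) auto
    then show ?thesis
      unfolding smallest_eigenvalue_def using finite_eigenvalues[OF sym] by (intro Min_le) auto
  qed
  have "x \<bullet> x = x \<bullet> (\<Sum>b\<in>B. (b \<bullet> x) *\<^sub>R b)"
    using B(4)[of x] by simp
  then have "smallest_eigenvalue A * (x \<bullet> x) = (\<Sum>b\<in>B. smallest_eigenvalue A * ((b \<bullet> x) * (b \<bullet> x)))"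
    by (simp add: inner_sum_right inner_commute sum_distrib_left)
  also have "\<dots> \<le> (\<Sum>b\<in>B. l b * ((b \<bullet> x) * (b \<bullet> x)))"
    using l by (intro sum_mono mult_right_mono) auto
  also have "\<dots> = x \<bullet> (A *v x)"
    using quadratic_form_eigenbasis[OF basis] by (simp add: mult_ac)
  finally show ?thesis .
qed

text \<open>Point \<open>i\<close> gets one coordinate \<open>sqrt (l b) * b $ i\<close> per
  eigenvector \<open>b\<close>; semidefiniteness makes each \<open>l b\<close> nonnegative.\<close>

lemma positive_semidefinite_gram:
  fixes A :: "real ^ 'n ^ 'n"
  assumes sym: "transpose A = A" and psd: "\<And>x. 0 \<le> x \<bullet> (A *v x)"
  shows "\<exists>(n::nat) (y :: 'n \<Rightarrow> nat \<Rightarrow> real). \<forall>i j. A $ i $ j = (\<Sum>k<n. y i k * y j k)"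
proof -
  obtain B l where basis: "orthonormal_eigenbasis A B l"
    using symmetric_matrix_spectral[OF sym] .
  note B = orthonormal_eigenbasisD[OF basis]
  have l: "0 \<le> l b" if "b \<in> B" for b
    using psd[of b] B(2,3)[OF that] by (simp add: norm_eq_1)
  \<comment> \<open>The eigenvectors are numbered because coordinates of points are indexed by
    natural numbers.\<close>
  obtain h where h: "bij_betw h {..<card B} B"
    using ex_bij_betw_nat_finite[OF B(1)] by (auto simp: atLeast0LessThan)
  let ?y = "\<lambda>i k. sqrt (l (h k)) * h k $ i"
  have "A $ i $ j = (\<Sum>k<card B. ?y i k * ?y j k)" for i j
  proof -
    have "A $ i $ j = axis i 1 \<bullet> (A *v axis j 1)"
      by (simp add: inner_axis' matrix_vector_mul_component inner_axis)
    also have "\<dots> = (\<Sum>b\<in>B. l b * (b $ i) * (b $ j))"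
      using quadratic_form_eigenbasis[OF basis] by (simp add: inner_axis)
    also have "\<dots> = (\<Sum>b\<in>B. (sqrt (l b) * b $ i) * (sqrt (l b) * b $ j))"
      using l by (intro sum.cong) (auto simp: algebra_simps simp flip: power2_eq_square)
    also have "\<dots> = (\<Sum>k<card B. ?y i k * ?y j k)"
      by (rule sum.reindex_bij_betw[OF h, symmetric])
    finally show ?thesis .
  qed
  then show ?thesis by (intro exI[of _ "card B"] exI[of _ ?y] allI)
qed

section \<open>The centering matrix as an orthogonal projection\<close>

lemma centering_matrix_component:
  "(centering_matrix :: real ^ 'm ^ 'm) $ i $ j = (if i = j then 1 else 0) - 1 / real CARD('m)"
  by (simp add: centering_matrix_def mat_def matrix_matrix_mult_def columnvector_def
      transpose_def)

lemma transpose_centering_matrix: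
  "transpose (centering_matrix :: real ^ 'm ^ 'm) = centering_matrix"
  by (simp add: vec_eq_iff transpose_def centering_matrix_component)

lemma centering_matrix_mult_vector:
  fixes x :: "real ^ 'm"
  shows "centering_matrix *v x = x - (sum (($) x) UNIV / real CARD('m)) *\<^sub>R 1"
  by (simp add: vec_eq_iff matrix_vector_mult_def centering_matrix_component left_diff_distrib
      sum_subtractf sum_divide_distrib if_distrib[of "\<lambda>c. c * _"] cong: if_cong)

text \<open>Centering subtracts the mean from every coordinate, and a centered vector has mean
  zero.\<close>

lemma centering_matrix_idem:
  "centering_matrix *v (centering_matrix *v x) = centering_matrix *v (x :: real ^ 'm)"
  by (simp add: centering_matrix_mult_vector sum_subtractf)

lemma inner_centering_matrix:
  "x \<bullet> (centering_matrix *v y) = (centering_matrix *v x) \<bullet> (y :: real ^ 'm)"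
  by (rule inner_symmetric_matrix[OF transpose_centering_matrix, symmetric])

section \<open>Realising the shifted dissimilarities as distances\<close>

theorem theorem5:
  fixes D :: "real ^ 'm ^ 'm" and \<sigma> :: real
  assumes "dissimilarity_matrix D"
    and "\<sigma> \<ge> - smallest_eigenvalue
           (centering_matrix ** ((- 1 / 2) *\<^sub>R squared_entries D) ** centering_matrix)"
  shows "euclidean_distance_matrix
           (\<chi> i j. if i = j then 0 else sqrt ((D $ i $ j)\<^sup>2 + 2 * \<sigma>))"
proof -
  define P where "P = (centering_matrix :: real ^ 'm ^ 'm)"
  define M where "M = (- 1 / 2) *\<^sub>R squared_entries D"
  define A where "A = P ** M ** P"
  define G where "G = A + \<sigma> *\<^sub>R P"
  have D: "D $ i $ j = D $ j $ i" "D $ i $ i = 0" for i j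
    using assms(1) unfolding dissimilarity_matrix_def transpose_def vec_eq_iff by auto
  have Mij: "M $ i $ j = - (D $ i $ j)\<^sup>2 / 2" for i j
    by (simp add: M_def squared_entries_def)
  have symM: "transpose M = M"
    by (simp add: vec_eq_iff transpose_def Mij D(1))
  have symP: "transpose P = P"
    unfolding P_def by (rule transpose_centering_matrix)
  have symA: "transpose A = A"
    by (simp add: A_def matrix_transpose_mul symM symP matrix_mul_assoc)
  have symG: "transpose G = G"
    using symA symP by (simp add: G_def vec_eq_iff transpose_def)
  \<comment> \<open>As \<open>P\<close> is symmetric and idempotent, the form of \<open>G\<close> at
    \<open>x\<close> is that of \<open>M\<close> plus \<open>\<sigma>\<close> times the identity at
    \<open>P *v x\<close>.\<close>
  have Gxx: "x \<bullet> (G *v x) = (P *v x) \<bullet> (M *v (P *v x)) + \<sigma> * ((P *v x) \<bullet> (P *v x))" for x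
  proof -
    have "(P *v x) \<bullet> (P *v x) = x \<bullet> (P *v x)"
      by (metis P_def centering_matrix_idem inner_centering_matrix)
    then show ?thesis
      by (simp add: G_def A_def matrix_vector_mult_add_rdistrib inner_add_right
          inner_centering_matrix P_def scaleR_matrix_vector_assoc[symmetric]
          flip: matrix_vector_mul_assoc)
  qed
  have "0 \<le> x \<bullet> (G *v x)" for x
  proof -
    let ?u = "P *v x"
    \<comment> \<open>The eigenvalue bound is applied at the centered vector, which \<open>P\<close>
      fixes, so that there the forms of \<open>A\<close> and \<open>M\<close> agree.\<close>
    have "- \<sigma> * (?u \<bullet> ?u) \<le> smallest_eigenvalue A * (?u \<bullet> ?u)"
      using assms(2) by (intro mult_right_mono) (auto simp: A_def M_def P_def)
    also have "\<dots> \<le> ?u \<bullet> (A *v ?u)"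
      by (rule smallest_eigenvalue_le_quadratic_form[OF symA])
    also have "\<dots> = ?u \<bullet> (M *v ?u)"
      by (simp add: A_def P_def inner_centering_matrix centering_matrix_idem
          flip: matrix_vector_mul_assoc)
    finally show ?thesis unfolding Gxx by simp
  qed
  from positive_semidefinite_gram[OF symG this] obtain n and y :: "'m \<Rightarrow> nat \<Rightarrow> real"
    where y: "\<forall>i j. G $ i $ j = (\<Sum>k<n. y i k * y j k)" by (elim exE)
  \<comment> \<open>Kept general in \<open>N\<close>: for \<open>G\<close> it gives a squared
    distance between the Gram points, for \<open>M\<close> a squared dissimilarity.\<close>
  have quad: "(axis i 1 - axis j 1) \<bullet> (N *v (axis i 1 - axis j 1))
      = N $ i $ i + N $ j $ j - N $ i $ j - N $ j $ i" for N :: "real ^ 'm ^ 'm" and i j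
    by (simp add: inner_axis' matrix_vector_mul_component inner_axis
        inner_diff_left inner_diff_right)
  have dist: "(\<Sum>k<n. (y i k - y j k)\<^sup>2) = (D $ i $ j)\<^sup>2 + 2 * \<sigma>" if "i \<noteq> j" for i j
  proof -
    let ?u = "axis i 1 - axis j 1 :: real ^ 'm"
    have Pu: "P *v ?u = ?u"
      by (simp add: P_def centering_matrix_mult_vector sum_subtractf axis_def)
    have uu: "?u \<bullet> ?u = 2"
      using that by (simp add: inner_diff_left inner_diff_right inner_axis_axis)
    have "(\<Sum>k<n. (y i k - y j k)\<^sup>2) = G $ i $ i + G $ j $ j - G $ i $ j - G $ j $ i"
      by (simp add: y power2_eq_square algebra_simps sum.distrib sum_subtractf sum_distrib_left)
    also have "\<dots> = ?u \<bullet> (G *v ?u)" by (rule quad[symmetric])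
    also have "\<dots> = ?u \<bullet> (M *v ?u) + 2 * \<sigma>" by (simp only: Gxx Pu uu mult.commute)
    \<comment> \<open>The diagonal of \<open>M\<close> is zero, and each of its two off-diagonal
      terms contributes half the squared dissimilarity.\<close>
    also have "\<dots> = (D $ i $ j)\<^sup>2 + 2 * \<sigma>"
      by (simp only: quad Mij) (simp add: D)
    finally show ?thesis .
  qed
  show ?thesis
    unfolding euclidean_distance_matrix_def
    by (intro exI[of _ n] exI[of _ y]) (simp add: L2_set_def dist)
qed

end
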